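(* Let $l,m,n$ be positive integers with $l\equiv m\pmod 2$ and $n\equiv 1\pmod 2$. Then, for any primitive $(mn+l)$-th root of unity $\zeta$ in $\mathbb{C}$, we have $$\mathrm{Re}\left(\sum_{k=1}^n\frac{\zeta^{k(km+l)/2}}{1-\zeta^{km}}\right)=-\frac{n+1}{4}.$$
   Context: $\mathrm{Re}$ denotes the real part. Since $l\equiv m\pmod 2$, the number $k(km+l)$ is even for every integer $k$, so the exponent $k(km+l)/2$ is an integer. *)

theory Defs
  imports Complex_Main
begin

definition primitive_root_of_unity :: "nat \<Rightarrow> 'a::monoid_mult \<Rightarrow> bool" where
  "primitive_root_of_unity N z \<longleftrightarrow> N > 0 \<and> z ^ N = 1 \<and> (\<forall>j. 0 < j \<and> j < N \<longrightarrow> z ^ j \<noteq> 1)"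

text \<open>
  Non-degeneracy of the quotients below: no denominator \<open>1 - z ^ (k * m)\<close> vanishes for
  \<open>1 \<le> k \<le> n\<close>, and the exponents \<open>(k * (k * m + l)) div 2\<close> are exact halves.
\<close>

lemma primitive_root_of_unity_denominator_nonzero:
  fixes z :: complex
  assumes "primitive_root_of_unity (m * n + l) z" "0 < l" "0 < m" "k \<in> {1..n}"
  shows "1 - z ^ (k * m) \<noteq> 0"
proof -
  have "k * m \<le> n * m"
    using assms(4) by (intro mult_le_mono1) simp
  then have "k * m < m * n + l"
    using assms(2) unfolding mult.commute[of n m] by linarith
  moreover have "0 < k * m"
    using assms(3,4) by simp
  ultimately show ?thesis
    using assms(1) unfolding primitive_root_of_unity_def by fastforce
qed

lemma exponent_even:
  fixes k l m :: nat
  assumes "l mod 2 = m mod 2"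
  shows "even (k * (k * m + l))"
proof -
  have "even l \<longleftrightarrow> even m"
    using assms by presburger
  then show ?thesis by auto
qed

end

(*
  Write zeta = cis t, phi = m t / 2 and N = m n + l. As N is even and zeta is primitive,
  zeta ^ (N div 2) = -1; substituting l = N - m n, the k-th summand becomes
  (-1)^k cis (-k phi (n - k)) / (1 - cis (2 k phi)), with real part
  (-1)^k sin (k phi (n + 1 - k)) / (2 sin (k phi)).  Passing from n to n + 2 changes the
  sine quotient by 2 cos (k phi (n + 2 - k)). For odd n, these cosines with signs (-1)^k cancel
  under k -> n + 2 - k, so that the sum of the quotients only changes by the
  contribution -1 of the new index k = n + 2.
*)
theory Submission
  imports Defs
begin

text \<open>Halving the angle gives 1 - cis (2x) = -2i sin x cis x. Dividing by it thus rotates by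
  -x and a quarter turn, and the quarter turn makes the real part a sine.\<close>

lemma Re_cis_divide_one_minus_cis:
  assumes "sin x \<noteq> 0"
  shows "Re (cis y / (1 - cis (2 * x))) = sin (x - y) / (2 * sin x)"
proof -
  have eq: "1 - cis (2 * x) = - (2 * \<i> * complex_of_real (sin x) * cis x)"
    by (simp add: complex_eq_iff cos_double_sin sin_double power2_eq_square)
  have "cis y = cis (y - x) * cis x"
    by (simp add: cis_mult)
  then have "cis y / (1 - cis (2 * x)) = \<i> * cis (y - x) / complex_of_real (2 * sin x)"
    unfolding eq using assms by (simp add: field_simps)
  also have "Re \<dots> = - sin (y - x) / (2 * sin x)"
    by (simp only: Re_divide_of_real) simp
  also have "\<dots> = sin (x - y) / (2 * sin x)"
    by (metis minus_diff_eq sin_minus)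
  finally show ?thesis .
qed

text \<open>The reflection k -> n + 2 - k preserves the product k (n + 2 - k), hence the cosine, but
  flips the parity of k because n + 2 is odd. The sum therefore equals its own negative.\<close>

lemma alternating_sum_cos_eq_0:
  fixes \<phi> :: real
  assumes "odd n"
  shows "(\<Sum>k = 1..n + 1. (-1) ^ k * cos (real k * \<phi> * (real n + 2 - real k))) = 0"
    (is "sum ?f _ = 0")
proof -
  have "sum ?f {1..n + 1} = (\<Sum>k = 1..n + 1. ?f (n + 2 - k))"
    by (rule sum.reindex_bij_witness[of _ "\<lambda>k. n + 2 - k" "\<lambda>k. n + 2 - k"]) auto
  also have "\<dots> = (\<Sum>k = 1..n + 1. - ?f k)"
  proof (rule sum.cong)
    fix k assume "k \<in> {1..n + 1}"
    then have k: "k \<le> n + 2" by simp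
    then have "even (n + 2 - k) \<longleftrightarrow> odd k"
      using assms by simp
    then have "(-1 :: real) ^ (n + 2 - k) = - ((-1) ^ k)"
      by (cases "even k") simp_all
    then show "?f (n + 2 - k) = - ?f k"
      using k by (simp add: mult_ac add.commute)
  qed simp
  finally show ?thesis
    by (simp add: sum_negf)
qed

text \<open>No root of unity is involved any more: the value is the same for every real angle that
  keeps the denominators nonzero. The induction runs through odd n in steps of two.\<close>

lemma alternating_sum_sin_quotient:
  fixes \<phi> :: real
  assumes "odd n" and "\<And>k. k \<in> {1..n} \<Longrightarrow> sin (real k * \<phi>) \<noteq> 0"
  shows "(\<Sum>k = 1..n. (-1) ^ k * (sin (real k * \<phi> * (real n + 1 - real k)) / sin (real k * \<phi>)))
    = - (real n + 1) / 2"
  using assms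
proof (induction n rule: less_induct)
  case (less n)
  let ?s = "\<lambda>n k. (-1) ^ k * (sin (real k * \<phi> * (real n + 1 - real k)) / sin (real k * \<phi>))"
  show ?case
  proof (cases "n = 1")
    case True
    then show ?thesis using less.prems by simp
  next
    case False
    then have "n \<ge> 2"
      using odd_pos[OF less.prems(1)] by linarith
    define p where "p = n - 2"
    have p: "n = p + 2" "odd p"
      using \<open>n \<ge> 2\<close> less.prems(1) by (simp_all add: p_def)
    have IH: "sum (?s p) {1..p} = - (real p + 1) / 2"
      using less.prems(2) p by (intro less.IH) auto
    \<comment> \<open>Here \<open>y\<close> is the midpoint of the two sine arguments, which lie at
      distance \<open>x\<close> on either side of it.\<close>
    have step: "?s n k = ?s p k + 2 * ((-1) ^ k * cos (real k * \<phi> * (real p + 2 - real k)))"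
      if "k \<in> {1..p + 1}" for k
    proof -
      define x where "x = real k * \<phi>"
      define y where "y = x * (real p + 2 - real k)"
      have "sin x \<noteq> 0"
        using less.prems(2) that p unfolding x_def by simp
      moreover have "sin (y + x) = sin (y - x) + 2 * cos y * sin x"
        by (simp add: sin_add sin_diff)
      ultimately have "sin (y + x) / sin x = sin (y - x) / sin x + 2 * cos y"
        by (simp add: field_simps)
      moreover have "y + x = x * (real n + 1 - real k)" "y - x = x * (real p + 1 - real k)"
        using p by (simp_all add: y_def algebra_simps)
      ultimately show ?thesis
        unfolding x_def[symmetric] y_def[symmetric] by (simp add: distrib_left)
    qed
    have "sum (?s n) {1..n} = sum (?s n) {1..p + 1} + ?s n n"
      using p by simp
    \<comment> \<open>At k = n the numerator and the denominator coincide, and n is odd.\<close>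
    also have "?s n n = -1"
      using less.prems(1) less.prems(2)[of n] p(1) by simp
    also have "sum (?s n) {1..p + 1} = sum (?s p) {1..p + 1}
        + 2 * (\<Sum>k = 1..p + 1. (-1) ^ k * cos (real k * \<phi> * (real p + 2 - real k)))"
      unfolding sum_distrib_left sum.distrib[symmetric] using step by (rule sum.cong[OF refl])
    also have "\<dots> = sum (?s p) {1..p + 1}"
      unfolding alternating_sum_cos_eq_0[OF p(2)] by simp
    \<comment> \<open>The extra index k = p + 1 contributes sin 0 = 0.\<close>
    also have "\<dots> = sum (?s p) {1..p}"
      by simp
    also note IH
    also have "- (real p + 1) / 2 + -1 = - (real n + 1) / 2"
      using p(1) by (simp add: field_simps)
    finally show ?thesis .
  qed
qed

text \<open>The power squares to 1, so in a domain it is 1 or -1; primitivity excludes 1, as 0 < N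
  div 2 < N.\<close>

lemma primitive_root_of_unity_power_half:
  fixes z :: "'a::idom"
  assumes "primitive_root_of_unity N z" "even N"
  shows "z ^ (N div 2) = -1"
proof -
  have "(z ^ (N div 2))\<^sup>2 = 1"
    using assms by (simp add: primitive_root_of_unity_def flip: power_mult)
  moreover have "z ^ (N div 2) \<noteq> 1"
    using assms by (auto simp: primitive_root_of_unity_def elim!: evenE)
  ultimately show ?thesis
    by (simp add: power2_eq_1_iff)
qed

lemma primitive_root_of_unity_eq_cis:
  fixes z :: complex
  assumes "primitive_root_of_unity N z"
  shows "z = cis (Arg z)"
proof -
  have "z ^ N = 1" "N > 0"
    using assms by (simp_all add: primitive_root_of_unity_def)
  then have "norm z = 1"
    by (metis norm_one norm_power norm_ge_zero power_eq_imp_eq_base power_one)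
  then show ?thesis
    using rcis_cmod_Arg[of z] by (simp add: rcis_def)
qed

theorem theorem2:
  fixes l m n :: nat and \<zeta> :: complex
  assumes "l > 0" and "m > 0" and "n > 0"
    and "l mod 2 = m mod 2"
    and "n mod 2 = 1"
    and "primitive_root_of_unity (m * n + l) \<zeta>"
  shows "Re (\<Sum>k = 1..n. \<zeta> ^ ((k * (k * m + l)) div 2) / (1 - \<zeta> ^ (k * m))) = - (real n + 1) / 4"
proof -
  define t where "t = Arg \<zeta>"
  define \<phi> where "\<phi> = real m * t / 2"
  define N where "N = m * n + l"
  have \<zeta>: "\<zeta> = cis t"
    unfolding t_def using assms(6) by (rule primitive_root_of_unity_eq_cis)
  have "odd n"
    using assms(5) by presburger
  have "even l \<longleftrightarrow> even m"
    using assms(4) by presburger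
  then have "even N"
    using \<open>odd n\<close> by (simp add: N_def)
  then have "cis (real N * t / 2) = \<zeta> ^ (N div 2)"
    by (simp add: \<zeta> DeMoivre real_of_nat_div)
  also have "\<dots> = -1"
    using assms(6) \<open>even N\<close> by (simp add: N_def primitive_root_of_unity_power_half)
  finally have half: "cis (real N * t / 2) = -1" .
  have den: "\<zeta> ^ (k * m) = cis (2 * (real k * \<phi>))" for k
    by (simp add: \<zeta> DeMoivre \<phi>_def mult_ac)
  have num: "\<zeta> ^ ((k * (k * m + l)) div 2)
      = (-1) ^ k * cis (real k * \<phi> * (real k - real n))" for k
  proof -
    have e: "real ((k * (k * m + l)) div 2) = real k * (real k * real m + real l) / 2"
      using exponent_even[OF assms(4), of k] by (simp add: real_of_nat_div)
    \<comment> \<open>With l = N - m n the angle splits into k copies of the half-period angle in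
      \<open>half\<close>, which give the sign (-1)^k, and a multiple of \<phi>.\<close>
    have "real ((k * (k * m + l)) div 2) * t
        = real k * (real N * t / 2) + real k * \<phi> * (real k - real n)"
      unfolding e by (simp add: N_def \<phi>_def field_simps)
    then show ?thesis
      by (simp add: \<zeta> DeMoivre flip: half cis_mult)
  qed
  have nz: "sin (real k * \<phi>) \<noteq> 0" if "k \<in> {1..n}" for k
  proof
    assume "sin (real k * \<phi>) = 0"
    then have "cis (2 * (real k * \<phi>)) = 1"
      by (simp add: complex_eq_iff cos_double_sin sin_double)
    then show False
      using primitive_root_of_unity_denominator_nonzero[OF assms(6,1,2) that] den by simp
  qed
  have summand: "Re (\<zeta> ^ ((k * (k * m + l)) div 2) / (1 - \<zeta> ^ (k * m)))
      = (-1) ^ k * (sin (real k * \<phi> * (real n + 1 - real k)) / sin (real k * \<phi>)) / 2"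
    if "k \<in> {1..n}" for k
  proof -
    let ?x = "real k * \<phi>" and ?y = "real k * \<phi> * (real k - real n)"
    \<comment> \<open>The sign is written as an embedded real so that it factors out of the real
      part.\<close>
    have "\<zeta> ^ ((k * (k * m + l)) div 2) / (1 - \<zeta> ^ (k * m))
        = complex_of_real ((-1) ^ k) * (cis ?y / (1 - cis (2 * ?x)))"
      unfolding num den by simp
    also have "Re \<dots> = (-1) ^ k * (sin (?x - ?y) / (2 * sin ?x))"
      unfolding Re_complex_of_real times_complex.sel
      by (simp add: Re_cis_divide_one_minus_cis nz[OF that] del: of_real_power)
    also have "?x - ?y = ?x * (real n + 1 - real k)"
      by (simp add: algebra_simps)
    finally show ?thesis by simp
  qed
  have "(\<Sum>k = 1..n. (-1) ^ k * (sin (real k * \<phi> * (real n + 1 - real k)) / sin (real k * \<phi>)))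
      = - (real n + 1) / 2"
    using \<open>odd n\<close> nz by (rule alternating_sum_sin_quotient)
  then have "(\<Sum>k = 1..n. (-1) ^ k * (sin (real k * \<phi> * (real n + 1 - real k)) / sin (real k * \<phi>)) / 2)
      = - (real n + 1) / 4"
    unfolding sum_divide_distrib[symmetric] by simp
  then show ?thesis
    unfolding Re_sum using summand by (metis (no_types, lifting) sum.cong)
qed

end
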